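(* Let $k\ge 1$, let $\Omega\subset\mathbb{R}^2$ be open and convex, and let $A\in C^k(\Omega,\mathbb{C}^{2\times 2})$. Let $\xi_0,\xi_1\in\Omega$ be two distinct generic cuspidal points (GCPs) of $A$, and suppose that $A(\xi)$ has distinct eigenvalues for all $\xi\in\Omega\setminus\{\xi_0,\xi_1\}$. Let $\Gamma\subset\Omega$ be a smooth Jordan curve enclosing both $\xi_0$ and $\xi_1$, parametrized by $\gamma$ in such a way that both $\gamma(\cdot)$ and $A(\gamma(\cdot))$ are $1$-periodic. Let $A(\gamma(t))=V(t)\Lambda(t)V^{-1}(t)$, $t\in\mathbb{R}$, $\Lambda=\mathrm{diag}(\lambda_1,\lambda_2)$, be a $C^k$ parallel-transport eigendecomposition. Then there are constants $\alpha_1,\alpha_2\in\mathbb{R}$ such that, for all $t\in\mathbb{R}$: (i) $\lambda_1(t+1)=\lambda_1(t)$ and $\lambda_2(t+1)=\lambda_2(t)$; (ii) $V^{-1}(t)V(t+1)=\begin{bmatrix}e^{i\alpha_1}&0\\0&e^{i\alpha_2}\end{bmatrix}$, with $\alpha_1+\alpha_2=0\pmod{2\pi}$.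
   Context: GCP for $2\times2$ functions: write $A(\xi)=\begin{bmatrix} a(\xi)&b(\xi)\\ c(\xi)&d(\xi)\end{bmatrix}$, $\Delta(\xi)=(a(\xi)-d(\xi))^2+4b(\xi)c(\xi)$ and $F(\xi)=(\mathrm{Re}\,\Delta(\xi),\mathrm{Im}\,\Delta(\xi))\in\mathbb{R}^2$. A point $\xi_0\in\Omega$ is a GCP of $A$ if $F(\xi_0)=0$ and the Jacobian $DF(\xi_0)$ is invertible. "$p$-periodic", when said of $\gamma(\cdot)$ and $A(\gamma(\cdot))$, means that $p$ is the minimal positive period. A smooth Jordan curve is a $C^1$, $1$-periodic map $\gamma:\mathbb{R}\to\mathbb{R}^2$ that is one-to-one on $[0,1)$; its image $\Gamma$ is also called a smooth Jordan curve. $\Gamma$ encloses a point if the point lies in the bounded component of $\mathbb{R}^2\setminus\Gamma$. Parallel-transport eigendecomposition: for a matrix function $B(t)\in\mathbb{C}^{n\times n}$ with distinct eigenvalues for all $t$, a $C^k$ eigendecomposition is $B(t)=V(t)\Lambda(t)V^{-1}(t)$ with $V=[v_1,\dots,v_n]$ invertible, $\Lambda=\mathrm{diag}(\lambda_1,\dots,\lambda_n)$, and $V,\Lambda$ of class $C^k$. Put $P(t)=V^{-1}(t)\dot V(t)$. It is a parallel-transport eigendecomposition if for all $j$ and $t$: $\mathrm{Re}(v_j^*v_jP_{jj})=-\sum_{l\ne j}\mathrm{Re}(v_j^*v_lP_{lj})$ (equivalently, $\|v_j(t)\|$ is constant in $t$), and $\mathrm{Im}(P_{jj}(t))=0$.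 *)

theory Defs
  imports "HOL-Analysis.Analysis" "HOL-Library.Real_Mod"
begin

text \<open>Class \<open>C\<^sup>k\<close> on a set \<open>S\<close>, to be used with open \<open>S\<close> only: the derivatives are full
  neighbourhood derivatives.\<close>

primrec Ck_on :: "nat \<Rightarrow> 'a::real_normed_vector set \<Rightarrow> ('a \<Rightarrow> 'b::real_normed_vector) \<Rightarrow> bool" where
  "Ck_on 0 S f \<longleftrightarrow> continuous_on S f"
| "Ck_on (Suc k) S f \<longleftrightarrow>
     (\<forall>x\<in>S. f differentiable (at x)) \<and> (\<forall>v. Ck_on k S (\<lambda>x. frechet_derivative f (at x) v))"

definition minimal_period :: "(real \<Rightarrow> 'a) \<Rightarrow> real \<Rightarrow> bool" where
  "minimal_period f p \<longleftrightarrow>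
     p > 0 \<and> (\<forall>t. f (t + p) = f t) \<and> (\<forall>q. 0 < q \<and> q < p \<longrightarrow> \<not> (\<forall>t. f (t + q) = f t))"

text \<open>No regularity (nonvanishing derivative) of the parametrization is required.\<close>

definition smooth_Jordan_curve :: "(real \<Rightarrow> real^2) \<Rightarrow> bool" where
  "smooth_Jordan_curve \<gamma> \<longleftrightarrow>
     \<gamma> C1_differentiable_on UNIV \<and> minimal_period \<gamma> 1 \<and> inj_on \<gamma> {0..<1}"

definition eigenvalues :: "complex^'n^'n \<Rightarrow> complex set" where
  "eigenvalues M = {\<mu>. \<exists>v. v \<noteq> 0 \<and> M *v v = \<mu> *s v}"

definition distinct_eigenvalues :: "complex^'n^'n \<Rightarrow> bool" where
  "distinct_eigenvalues M \<longleftrightarrow> card (eigenvalues M) = CARD('n)"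

definition discr :: "complex^2^2 \<Rightarrow> complex" where
  "discr M = (M$1$1 - M$2$2)\<^sup>2 + 4 * M$1$2 * M$2$1"

definition discr_map :: "(real^2 \<Rightarrow> complex^2^2) \<Rightarrow> real^2 \<Rightarrow> real^2" where
  "discr_map A \<xi> = vector [Re (discr (A \<xi>)), Im (discr (A \<xi>))]"

definition generic_cuspidal_point :: "(real^2) set \<Rightarrow> (real^2 \<Rightarrow> complex^2^2) \<Rightarrow> real^2 \<Rightarrow> bool" where
  "generic_cuspidal_point \<Omega> A \<xi> \<longleftrightarrow>
     \<xi> \<in> \<Omega> \<and> discr_map A \<xi> = 0 \<and>
     discr_map A differentiable (at \<xi>) \<and> invertible (jacobian (discr_map A) (at \<xi>))"

definition diag_matrix :: "'a::zero^'n \<Rightarrow> 'a^'n^'n" where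
  "diag_matrix d = (\<chi> i j. if i = j then d$i else 0)"

definition herm_prod :: "complex^'n \<Rightarrow> complex^'n \<Rightarrow> complex" where
  "herm_prod v w = (\<Sum>i\<in>UNIV. cnj (v$i) * w$i)"

definition Ck_eigendecomposition ::
    "nat \<Rightarrow> (real \<Rightarrow> complex^'n^'n) \<Rightarrow> (real \<Rightarrow> complex^'n^'n) \<Rightarrow> (real \<Rightarrow> complex^'n) \<Rightarrow> bool" where
  "Ck_eigendecomposition k B V \<mu> \<longleftrightarrow>
     Ck_on k UNIV V \<and> Ck_on k UNIV (\<lambda>t. diag_matrix (\<mu> t)) \<and>
     (\<forall>t. invertible (V t) \<and> B t = V t ** diag_matrix (\<mu> t) ** matrix_inv (V t))"

definition transport_matrix :: "(real \<Rightarrow> complex^'n^'n) \<Rightarrow> real \<Rightarrow> complex^'n^'n" where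
  "transport_matrix V t = matrix_inv (V t) ** vector_derivative V (at t)"

definition parallel_transport_eigendecomposition ::
    "nat \<Rightarrow> (real \<Rightarrow> complex^'n^'n) \<Rightarrow> (real \<Rightarrow> complex^'n^'n) \<Rightarrow> (real \<Rightarrow> complex^'n) \<Rightarrow> bool" where
  "parallel_transport_eigendecomposition k B V \<mu> \<longleftrightarrow>
     Ck_eigendecomposition k B V \<mu> \<and>
     (\<forall>j t. Re (herm_prod (column j (V t)) (column j (V t)) * transport_matrix V t $ j $ j) =
              - (\<Sum>l\<in>UNIV - {j}.
                   Re (herm_prod (column j (V t)) (column l (V t)) * transport_matrix V t $ l $ j))
          \<and> Im (transport_matrix V t $ j $ j) = 0)"

end

theory Submission
  imports Defs
begin

text \<open>Identify \<open>\<real>\<^sup>2\<close> with the complex plane. Near a GCP \<open>\<xi>\<close> the discriminant \<open>f\<close> is, up to a factor with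
  values in a disc avoiding \<open>0\<close>, either \<open>z - \<xi>\<close> or its conjugate. Dividing by these two factors and
  correcting the quotient near \<open>\<xi>\<^sub>0, \<xi>\<^sub>1\<close> gives a continuous nonvanishing function on the convex
  set \<open>\<Omega>\<close>, hence a square. Since \<open>\<xi>\<^sub>0\<close> and \<open>\<xi>\<^sub>1\<close> lie in the same component of the complement
  of \<open>\<Gamma>\<close> (Jordan curve theorem), \<open>(z - \<xi>\<^sub>1) / (z - \<xi>\<^sub>0)\<close> has a continuous logarithm on \<open>\<Gamma>\<close>, so
  the product of the two factors is a square on \<open>\<Gamma>\<close> for each of the four sign patterns. Thus \<open>f\<close>
  has a single-valued square root on \<open>\<Gamma>\<close>, equal to \<open>\<plusminus>(\<mu>\<^sub>1 - \<mu>\<^sub>2)\<close>, and the eigenvalues return to themselves.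

  Consequently \<open>V(t + 1) = V(t) D(t)\<close> with \<open>D\<close> diagonal. The two transport conditions force \<open>D\<close> to
  be constant with unimodular entries, and \<open>(det V)' = tr P \<cdot> det V\<close> with \<open>tr P\<close> real shows that
  \<open>det D > 0\<close>, so \<open>det D = 1\<close>.\<close>

section \<open>Square roots of planar maps with two simple zeros\<close>

text \<open>The inverse \<open>g\<close> carries the component of \<open>f x\<close> off the image
  of \<open>S\<close> into the component of \<open>x\<close> off \<open>S\<close>, so the former
  lies in the \<open>f\<close>-image of a bounded set; \<open>bnd\<close> makes that image
  bounded.\<close>

lemma inside_homeomorphism_image:
  assumes hom: "homeomorphism UNIV UNIV f g"
    and bnd: "\<And>X. bounded X \<Longrightarrow> bounded (f ` X)"
    and x: "x \<in> inside S"
  shows "f x \<in> inside (f ` S)"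
proof -
  have gf: "g (f y) = y" and fg: "f (g z) = z" for y z
    using hom by (auto simp: homeomorphism_def)
  have comp: "- f ` S = f ` (- S)"
    using bij_image_Compl_eq[of f S] gf fg by (metis bijI')
  have "homeomorphism (- f ` S) (- S) g f"
    using homeomorphism_of_subsets[OF homeomorphism_symD[OF hom], of "- f ` S" "- S"] comp gf
    by (auto simp: image_image)
  then have "connected_component_set (- f ` S) (f x) \<subseteq> f ` connected_component_set (- S) x"
  proof (intro subsetI)
    fix y assume "homeomorphism (- f ` S) (- S) g f" "y \<in> connected_component_set (- f ` S) (f x)"
    then have "connected_component (- S) (g (f x)) (g y)"
      by (simp add: connected_component_homeomorphismI)
    then show "y \<in> f ` connected_component_set (- S) x"
      by (intro image_eqI[of _ _ "g y"]) (simp_all add: gf fg)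
  qed
  moreover have "f x \<notin> f ` S" "bounded (connected_component_set (- S) x)"
    using x gf by (auto simp: inside_def) metis
  ultimately show ?thesis
    by (auto simp: inside_def intro: bounded_subset bnd)
qed

text \<open>By the Jordan curve theorem the inside is itself connected, and it misses the curve, so
  it serves as the connected set containing \<open>a\<close> and \<open>b\<close>.\<close>

lemma inside_Jordan_curve_connected_component:
  fixes g :: "real \<Rightarrow> complex"
  assumes "simple_path g" "pathfinish g = pathstart g"
    and "a \<in> inside (path_image g)" "b \<in> inside (path_image g)"
  shows "connected_component (- path_image g) a b"
  using Jordan_inside_outside[OF assms(1,2)] assms(3,4) inside_no_overlap
  unfolding connected_component_def by (metis disjoint_eq_subset_Compl)

text \<open>A path from \<open>b\<close> to \<open>a\<close> off \<open>S\<close> deforms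
  \<open>(z - b) / |z - b|\<close> into \<open>(z - a) / |z - a|\<close>, so their quotient is a
  null-homotopic circle map and lifts through \<open>exp\<close>. The logarithm of the ratio of
  moduli supplies the real part.\<close>

lemma continuous_quotient_logarithm:
  fixes S :: "complex set"
  assumes "compact S" "connected_component (- S) a b"
  obtains q where "continuous_on S q" "\<And>z. z \<in> S \<Longrightarrow> z - b = (z - a) * exp (q z)"
proof -
  have a: "a \<notin> S" and b: "b \<notin> S"
    using assms(2) connected_component_in by blast+
  have "path_component (- S) b a"
    using assms by (metis connected_component_sym open_Compl compact_imp_closed open_path_connected_component)
  from iffD1[OF homotopic_circlemaps_divide Borsuk_maps_homotopic_in_path_component[OF this]]
  obtain c where "homotopic_with_canon (\<lambda>x. True) S (sphere 0 1)
      (\<lambda>z. inverse (norm (z - b)) *\<^sub>R (z - b) / (inverse (norm (z - a)) *\<^sub>R (z - a))) (\<lambda>x. c)"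
    by blast
  then obtain h where h: "continuous_on S h"
    "\<And>z. z \<in> S \<Longrightarrow> inverse (norm (z - b)) *\<^sub>R (z - b) / (inverse (norm (z - a)) *\<^sub>R (z - a)) = exp (\<i> * of_real (h z))"
    using iffD1[OF inessential_eq_continuous_logarithm_circle] by blast
  show ?thesis
  proof
    show "continuous_on S (\<lambda>z. of_real (ln (norm (z - b) / norm (z - a))) + \<i> * of_real (h z))"
      using a b h(1) by (intro continuous_intros) auto
    fix z assume z: "z \<in> S"
    then have "z \<noteq> a" "z \<noteq> b" using a b by auto
    then have "exp (of_real (ln (norm (z - b) / norm (z - a)))) = complex_of_real (norm (z - b) / norm (z - a))"
      by (simp add: exp_of_real)
    then show "z - b = (z - a) * exp (of_real (ln (norm (z - b) / norm (z - a))) + \<i> * of_real (h z))"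
      unfolding exp_add h(2)[OF z, symmetric] using \<open>z \<noteq> a\<close> \<open>z \<noteq> b\<close>
      by (simp add: scaleR_conv_of_real field_simps)
  qed
qed

section \<open>Removal of simple zeros\<close>

text \<open>\<open>a\<close> and \<open>b\<close> are the Wirtinger coefficients of
  \<open>L\<close>, whose real determinant is \<open>|a|^2 - |b|^2\<close>. Equal moduli would
  produce a nonzero kernel vector.\<close>

lemma real_linear_complex_decomposition:
  fixes L :: "complex \<Rightarrow> complex"
  assumes "linear L" "inj L"
  obtains a b where "\<And>z. L z = a * z + b * cnj z" "norm a \<noteq> norm b"
proof -
  define a where "a = (L 1 - \<i> * L \<i>) / 2"
  define b where "b = (L 1 + \<i> * L \<i>) / 2"
  have L: "L z = a * z + b * cnj z" for z
  proof -
    have "z = Re z *\<^sub>R 1 + Im z *\<^sub>R \<i>" by (simp add: complex_eq_iff)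
    then have "L z = Re z *\<^sub>R L 1 + Im z *\<^sub>R L \<i>"
      using linear_add[OF assms(1)] linear_scale[OF assms(1)] by metis
    then show ?thesis
      by (simp add: a_def b_def complex_eq_iff field_simps)
  qed
  have "norm a \<noteq> norm b"
  proof
    assume eq: "norm a = norm b"
    \<comment> \<open>For nonzero \<open>a\<close>, the choice \<open>a * w^2 = - b\<close> forces
      \<open>|w| = 1\<close>, so \<open>L w * w = a * w^2 + b * |w|^2 = 0\<close>. If
      \<open>a = 0\<close>, then \<open>b = 0\<close> and \<open>L\<close> vanishes
      identically.\<close>
    define w where "w = (if a = 0 then 1 else csqrt (- b / a))"
    have "w \<noteq> 0" using eq by (auto simp: w_def)
    have "L w = 0"
    proof (cases "a = 0")
      case False
      have w2: "w ^ 2 = - b / a" using False by (simp add: w_def)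
      then have "norm w ^ 2 = 1" using eq False by (auto simp flip: norm_power simp add: norm_divide)
      then have "w * cnj w = 1" using complex_norm_square[of w] by simp
      moreover have "a * w ^ 2 + b = 0" using w2 False by (simp add: field_simps)
      ultimately have "L w * w = 0"
        unfolding L by (simp add: algebra_simps power2_eq_square)
      then show ?thesis using \<open>w \<noteq> 0\<close> by simp
    qed (use eq L in auto)
    then show False
      using assms \<open>w \<noteq> 0\<close> by (simp add: linear_injective_0)
  qed
  with L that show thesis by blast
qed

text \<open>Near a simple zero \<open>f\<close> behaves like \<open>a w + b (cnj w)\<close> with \<open>w = z - \<xi>\<close>; division by
  \<open>w\<close> or by \<open>cnj w\<close>, whichever carries the larger coefficient, leaves values in a disc that
  avoids \<open>0\<close>.\<close>

lemma simple_zero_factor: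
  fixes f :: "complex \<Rightarrow> complex"
  assumes "f \<xi> = 0" "(f has_derivative L) (at \<xi>)" "inj L"
  obtains p c where "p \<in> {\<lambda>z. z - \<xi>, \<lambda>z. cnj (z - \<xi>)}"
    "\<forall>\<^sub>F z in at \<xi>. norm (f z / p z - c) < norm c"
proof -
  obtain a b where L: "\<And>z. L z = a * z + b * cnj z" and ab: "norm a \<noteq> norm b"
    using real_linear_complex_decomposition has_derivative_linear[OF assms(2)] assms(3) by metis
  \<comment> \<open>The gap between the moduli is the permitted error: the smaller modulus plus
    \<open>e\<close> is the larger one, which is the radius of the disc.\<close>
  define e where "e = \<bar>norm a - norm b\<bar>"
  have e: "e > 0" using ab by (simp add: e_def)
  have "((\<lambda>y. (f y - f \<xi> - L (y - \<xi>)) /\<^sub>R norm (y - \<xi>)) \<longlongrightarrow> 0) (at \<xi>)"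
    using assms(2) by (simp add: has_derivative_at_within)
  from tendstoD[OF this e]
  have ev: "\<forall>\<^sub>F z in at \<xi>. z \<noteq> \<xi> \<and> norm (f z - L (z - \<xi>)) < e * norm (z - \<xi>)"
    unfolding eventually_at by (force simp: assms(1) divide_simps mult.commute)
  show thesis
  proof (cases "norm b < norm a")
    case True
    have "norm (f z / (z - \<xi>) - a) < norm a" if "z \<noteq> \<xi>" "norm (f z - L (z - \<xi>)) < e * norm (z - \<xi>)" for z
    proof -
      have "f z / (z - \<xi>) - a = (f z - L (z - \<xi>) + b * cnj (z - \<xi>)) / (z - \<xi>)"
        using that(1) by (simp add: L field_simps)
      also have "norm \<dots> \<le> (norm (f z - L (z - \<xi>)) + norm b * norm (z - \<xi>)) / norm (z - \<xi>)"
        unfolding norm_divide by (intro divide_right_mono) (metis complex_mod_cnj norm_mult norm_triangle_ineq, simp)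
      also have "\<dots> < e + norm b"
        using that by (simp add: field_simps)
      finally show ?thesis using True by (simp add: e_def)
    qed
    then show thesis using ev by (intro that[of "\<lambda>z. z - \<xi>" a]) (auto elim: eventually_mono)
  next
    case False
    have "norm (f z / cnj (z - \<xi>) - b) < norm b" if "z \<noteq> \<xi>" "norm (f z - L (z - \<xi>)) < e * norm (z - \<xi>)" for z
    proof -
      have "f z / cnj (z - \<xi>) - b = (f z - L (z - \<xi>) + a * (z - \<xi>)) / cnj (z - \<xi>)"
        using that(1) by (simp add: L field_simps)
      also have "norm \<dots> \<le> (norm (f z - L (z - \<xi>)) + norm a * norm (z - \<xi>)) / norm (z - \<xi>)"
        unfolding norm_divide complex_mod_cnj
        by (intro divide_right_mono) (metis norm_mult norm_triangle_ineq, simp)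
      also have "\<dots> < e + norm a"
        using that by (simp add: field_simps)
      finally show ?thesis using False ab by (simp add: e_def)
    qed
    then show thesis using ev by (intro that[of "\<lambda>z. cnj (z - \<xi>)" b]) (auto elim: eventually_mono)
  qed
qed

text \<open>Near \<open>\<xi>\<close> the quotient \<open>f / p\<close> stays in an open disc about
  \<open>c\<close> that omits 0, but it need not converge at \<open>\<xi>\<close>. Pulling it
  towards \<open>c\<close> along segments keeps it in the disc and makes it continuous; the
  factorisation survives outside the ball.\<close>

lemma remove_simple_zero:
  fixes f :: "complex \<Rightarrow> complex"
  assumes "continuous_on \<Omega> f" "f \<xi> = 0" "(f has_derivative L) (at \<xi>)" "inj L" "\<epsilon> > 0"
  obtains p g where "p \<in> {\<lambda>z. z - \<xi>, \<lambda>z. cnj (z - \<xi>)}" "continuous_on \<Omega> g"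
    "\<And>z. z \<notin> ball \<xi> \<epsilon> \<Longrightarrow> f z = g z * p z"
    "\<And>z. g z = 0 \<longleftrightarrow> f z = 0 \<and> z \<noteq> \<xi>"
proof -
  obtain p c where p: "p \<in> {\<lambda>z. z - \<xi>, \<lambda>z. cnj (z - \<xi>)}"
    and ev: "\<forall>\<^sub>F z in at \<xi>. norm (f z / p z - c) < norm c"
    using simple_zero_factor[OF assms(2-4)] by metis
  obtain r0 where "r0 > 0" and r0: "\<And>z. z \<noteq> \<xi> \<Longrightarrow> dist z \<xi> < r0 \<Longrightarrow> norm (f z / p z - c) < norm c"
    using ev by (auto simp: eventually_at)
  define r where "r = min r0 \<epsilon>"
  have r: "r > 0" "r \<le> \<epsilon>" and close: "\<And>z. z \<noteq> \<xi> \<Longrightarrow> dist z \<xi> < r \<Longrightarrow> norm (f z / p z - c) < norm c"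
    using \<open>r0 > 0\<close> assms(5) r0 by (auto simp: r_def)
  have "c \<noteq> 0"
  proof -
    have "\<exists>z. z \<noteq> \<xi> \<and> dist z \<xi> < r"
      using r(1) by (intro exI[of _ "\<xi> + of_real (r / 2)"]) (auto simp: dist_norm)
    then show ?thesis using close by (metis norm_not_less_zero norm_zero)
  qed
  have p0: "p z \<noteq> 0" if "z \<noteq> \<xi>" for z using p that by auto
  have contp: "continuous_on A p" for A
    using p by (auto intro!: continuous_intros)
  \<comment> \<open>The weight is 0 at \<open>\<xi>\<close> and 1 from distance \<open>r\<close> on.
    Hence \<open>g \<xi> = c\<close>, whatever value the division by zero takes.\<close>
  define \<theta> where "\<theta> z = min 1 (dist z \<xi> / r)" for z
  define g where "g z = c + of_real (\<theta> z) * (f z / p z - c)" for z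
  have \<theta>01: "0 \<le> \<theta> z" "\<theta> z \<le> 1" for z using r by (auto simp: \<theta>_def)
  have far: "g z = f z / p z" if "\<not> dist z \<xi> < r" for z
    using that r by (simp add: g_def \<theta>_def)
  have near: "norm (g z - c) \<le> \<theta> z * norm c" if "dist z \<xi> < r" for z
  proof (cases "z = \<xi>")
    case True
    then show ?thesis by (simp add: g_def \<theta>_def)
  next
    case False
    then show ?thesis using close[OF False that] \<theta>01[of z]
      by (simp add: g_def norm_mult mult_left_mono)
  qed
  have \<theta>1: "\<theta> z < 1" if "dist z \<xi> < r" for z using that r by (simp add: \<theta>_def)
  show thesis
  proof
    show "p \<in> {\<lambda>z. z - \<xi>, \<lambda>z. cnj (z - \<xi>)}" by fact
    show "f z = g z * p z" if "z \<notin> ball \<xi> \<epsilon>" for z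
      using that r far[of z] p0[of z] assms(5) by (cases "z = \<xi>") (auto simp: dist_commute)
    show "g z = 0 \<longleftrightarrow> f z = 0 \<and> z \<noteq> \<xi>" for z
    proof (cases "dist z \<xi> < r")
      case True
      have "norm (g z - c) < norm c"
        using near[OF True] \<theta>1[OF True] \<open>c \<noteq> 0\<close> by (smt (verit) mult_le_cancel_right1 zero_less_norm_iff)
      then have "g z \<noteq> 0" by auto
      moreover have "f z \<noteq> 0" if "z \<noteq> \<xi>" using close[OF that True] by auto
      ultimately show ?thesis by auto
    next
      case False
      then show ?thesis using far[OF False] p0[of z] r by (cases "z = \<xi>") auto
    qed
    show "continuous_on \<Omega> g"
      unfolding continuous_on_eq_continuous_within
    proof
      fix z assume z: "z \<in> \<Omega>"
      show "continuous (at z within \<Omega>) g"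
      proof (cases "z = \<xi>")
        case False
        have "continuous_on (\<Omega> - {\<xi>}) g"
          unfolding g_def \<theta>_def using p0 r
          by (intro continuous_intros contp continuous_on_subset[OF assms(1)]) auto
        then have "continuous (at z within (\<Omega> - {\<xi>})) g"
          using z False by (simp add: continuous_on_eq_continuous_within)
        moreover have "at z within (\<Omega> - {\<xi>}) = at z within \<Omega>"
          using False by (intro at_within_nhd[of _ "- {\<xi>}"]) auto
        ultimately show ?thesis by simp
      next
        case True
        have "((\<lambda>w. g w - c) \<longlongrightarrow> 0) (at \<xi> within \<Omega>)"
        proof (rule Lim_null_comparison)
          show "\<forall>\<^sub>F w in at \<xi> within \<Omega>. norm (g w - c) \<le> \<theta> w * norm c"
            using near r by (auto simp: eventually_at)
          have "((\<lambda>w. \<theta> w * norm c) \<longlongrightarrow> min 1 (dist \<xi> \<xi> / r) * norm c) (at \<xi> within \<Omega>)"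
            unfolding \<theta>_def using r by (intro tendsto_intros) auto
          then show "((\<lambda>w. \<theta> w * norm c) \<longlongrightarrow> 0) (at \<xi> within \<Omega>)" by simp
        qed
        moreover have "g \<xi> = c" by (simp add: g_def \<theta>_def)
        ultimately show ?thesis
          using True by (simp add: continuous_within LIM_zero_cancel)
      qed
    qed
  qed
qed

text \<open>In the quotient rule the term containing \<open>P\<close> carries the factor
  \<open>f \<xi> = 0\<close>.\<close>

lemma has_derivative_divide_at_zero:
  fixes f p :: "complex \<Rightarrow> complex"
  assumes "f \<xi> = 0" "(f has_derivative L) (at \<xi>)" "(p has_derivative P) (at \<xi>)" "p \<xi> \<noteq> 0"
  shows "((\<lambda>z. f z / p z) has_derivative (\<lambda>v. L v / p \<xi>)) (at \<xi>)"
  using has_derivative_divide[OF assms(2,3,4)] assms(1) by (simp add: divide_inverse)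

text \<open>The zeros are divided out one after the other. What remains has no zero on the
  contractible set \<open>\<Omega>\<close> and is a square there; the position of \<open>S\<close>
  matters for the product of the two factors only.\<close>

lemma continuous_sqrt_two_simple_zeros:
  fixes f :: "complex \<Rightarrow> complex"
  assumes "convex \<Omega>" "continuous_on \<Omega> f" "\<xi>0 \<noteq> \<xi>1"
    and d0: "f \<xi>0 = 0" "(f has_derivative L0) (at \<xi>0)" "inj L0"
    and d1: "f \<xi>1 = 0" "(f has_derivative L1) (at \<xi>1)" "inj L1"
    and nz: "\<And>z. z \<in> \<Omega> - {\<xi>0, \<xi>1} \<Longrightarrow> f z \<noteq> 0"
    and S: "compact S" "S \<subseteq> \<Omega>" "connected_component (- S) \<xi>0 \<xi>1"
  obtains \<sigma> where "continuous_on S \<sigma>" "\<And>z. z \<in> S \<Longrightarrow> f z = (\<sigma> z)\<^sup>2"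
proof -
  have \<xi>S: "\<xi>0 \<in> - S" "\<xi>1 \<in> - S"
    using S(3) connected_component_in by blast+
  \<comment> \<open>The balls avoid \<open>S\<close>, so both factorisations are exact on
    \<open>S\<close>. The first ball also avoids \<open>\<xi>1\<close>, so the correction at
    \<open>\<xi>0\<close> does not disturb the derivative at \<open>\<xi>1\<close>.\<close>
  have "open (- S - {\<xi>1})" "open (- S)" using S(1) by (auto intro!: open_delete compact_imp_closed)
  then obtain \<epsilon>0 \<epsilon>1 where \<epsilon>: "\<epsilon>0 > 0" "cball \<xi>0 \<epsilon>0 \<subseteq> - S - {\<xi>1}" "\<epsilon>1 > 0" "cball \<xi>1 \<epsilon>1 \<subseteq> - S"
    using \<xi>S assms(3) unfolding open_contains_cball by (metis Diff_iff singletonD)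
  obtain p0 g0 where p0: "p0 \<in> {\<lambda>z. z - \<xi>0, \<lambda>z. cnj (z - \<xi>0)}" and g0: "continuous_on \<Omega> g0"
    "\<And>z. z \<notin> ball \<xi>0 \<epsilon>0 \<Longrightarrow> f z = g0 z * p0 z" "\<And>z. g0 z = 0 \<longleftrightarrow> f z = 0 \<and> z \<noteq> \<xi>0"
    by (rule remove_simple_zero[OF assms(2) d0 \<epsilon>(1)]) blast
  have p0nz: "p0 z \<noteq> 0" if "z \<noteq> \<xi>0" for z using p0 that by auto
  obtain P where "(p0 has_derivative P) (at \<xi>1)"
  proof -
    have "((\<lambda>z. z - \<xi>0) has_derivative (\<lambda>v. v)) (at \<xi>1)"
      by (auto intro!: derivative_eq_intros)
    then show thesis using p0 that has_derivative_cnj by blast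
  qed
  from has_derivative_divide_at_zero[OF d1(1,2) this] p0nz assms(3)
  have "((\<lambda>z. f z / p0 z) has_derivative (\<lambda>v. L1 v / p0 \<xi>1)) (at \<xi>1)" by auto
  moreover
  have "\<forall>\<^sub>F z in nhds \<xi>1. f z / p0 z = g0 z"
  proof (rule eventually_nhds_in_open[THEN eventually_mono])
    show "\<xi>1 \<in> - cball \<xi>0 \<epsilon>0" "open (- cball \<xi>0 \<epsilon>0)" using \<epsilon> by auto
    show "f z / p0 z = g0 z" if "z \<in> - cball \<xi>0 \<epsilon>0" for z
      using that g0(2)[of z] p0nz[of z] \<epsilon>(1) by force
  qed
  then have "\<forall>\<^sub>F z in at \<xi>1. f z / p0 z = g0 z" "f \<xi>1 / p0 \<xi>1 = g0 \<xi>1"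
    by (auto simp: eventually_at_filter eventually_mono dest: eventually_nhds_x_imp_x)
  \<comment> \<open>Near \<open>\<xi>1\<close> the function \<open>g0\<close> is
    \<open>f / p0\<close>, so it inherits the simple zero of \<open>f\<close> and the second zero
    can be removed from it.\<close>
  ultimately have dg: "(g0 has_derivative (\<lambda>v. L1 v / p0 \<xi>1)) (at \<xi>1)"
    by (rule has_derivative_transform_eventually) auto
  have injg: "inj (\<lambda>v. L1 v / p0 \<xi>1)"
    using d1(3) p0nz assms(3) by (auto simp: inj_def)
  have "g0 \<xi>1 = 0" using g0(3) d1(1) assms(3) by auto
  from remove_simple_zero[OF g0(1) this dg injg \<epsilon>(3)] obtain p1 g1
    where p1: "p1 \<in> {\<lambda>z. z - \<xi>1, \<lambda>z. cnj (z - \<xi>1)}" and g1: "continuous_on \<Omega> g1"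
    "\<And>z. z \<notin> ball \<xi>1 \<epsilon>1 \<Longrightarrow> g0 z = g1 z * p1 z" "\<And>z. g1 z = 0 \<longleftrightarrow> g0 z = 0 \<and> z \<noteq> \<xi>1"
    by blast
  have "g1 z \<noteq> 0" if "z \<in> \<Omega>" for z using nz that g1(3) g0(3) by blast
  then obtain s where s: "continuous_on \<Omega> s" "\<And>z. z \<in> \<Omega> \<Longrightarrow> g1 z = (s z)\<^sup>2"
    using continuous_sqrt_on_contractible[OF g1(1) convex_imp_contractible[OF assms(1)]] by blast
  obtain q where q: "continuous_on S q" "\<And>z. z \<in> S \<Longrightarrow> z - \<xi>1 = (z - \<xi>0) * exp (q z)"
    using continuous_quotient_logarithm[OF S(1,3)] by blast
  have f: "f z = (s z)\<^sup>2 * (p0 z * p1 z)" if "z \<in> S" for z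
  proof -
    have "z \<notin> ball \<xi>0 \<epsilon>0" "z \<notin> ball \<xi>1 \<epsilon>1" using that \<epsilon> ball_subset_cball by blast+
    then show ?thesis using g0(2) g1(2) s(2) that S(2) by auto
  qed
  have sq: "(exp (w / 2))\<^sup>2 = exp w" for w :: complex
    by (simp flip: exp_double)
  have nsq: "(complex_of_real (norm w))\<^sup>2 = w * cnj w" for w
    by (metis complex_norm_square of_real_power)
  \<comment> \<open>Substituting \<open>z - \<xi>1 = (z - \<xi>0) * exp (q z)\<close> turns the
    product into \<open>(z - \<xi>0)^2\<close>, its conjugate, or \<open>|z - \<xi>0|^2\<close>,
    times the exponential of \<open>q z\<close> or of its conjugate; each has an explicit
    root.\<close>
  have "\<exists>\<tau>. continuous_on S \<tau> \<and> (\<forall>z\<in>S. p0 z * p1 z = (\<tau> z)\<^sup>2)"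
  proof -
    consider "p0 = (\<lambda>z. z - \<xi>0)" "p1 = (\<lambda>z. z - \<xi>1)" | "p0 = (\<lambda>z. z - \<xi>0)" "p1 = (\<lambda>z. cnj (z - \<xi>1))"
      | "p0 = (\<lambda>z. cnj (z - \<xi>0))" "p1 = (\<lambda>z. z - \<xi>1)" | "p0 = (\<lambda>z. cnj (z - \<xi>0))" "p1 = (\<lambda>z. cnj (z - \<xi>1))"
      using p0 p1 by blast
    then show ?thesis
    proof cases
      case 1
      have "p0 z * p1 z = ((z - \<xi>0) * exp (q z / 2))\<^sup>2" if "z \<in> S" for z
        unfolding 1 power_mult_distrib sq q(2)[OF that] by (simp add: power2_eq_square)
      then show ?thesis using q(1) by (intro exI[of _ "\<lambda>z. (z - \<xi>0) * exp (q z / 2)"]) (auto intro!: continuous_intros)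
    next
      case 2
      have "p0 z * p1 z = (of_real (norm (z - \<xi>0)) * exp (cnj (q z) / 2))\<^sup>2" if "z \<in> S" for z
        unfolding 2 power_mult_distrib sq q(2)[OF that] nsq by (simp add: exp_cnj)
      then show ?thesis using q(1)
        by (intro exI[of _ "\<lambda>z. of_real (norm (z - \<xi>0)) * exp (cnj (q z) / 2)"]) (auto intro!: continuous_intros)
    next
      case 3
      have "p0 z * p1 z = (of_real (norm (z - \<xi>0)) * exp (q z / 2))\<^sup>2" if "z \<in> S" for z
        unfolding 3 power_mult_distrib sq q(2)[OF that] nsq by (simp add: mult_ac)
      then show ?thesis using q(1)
        by (intro exI[of _ "\<lambda>z. of_real (norm (z - \<xi>0)) * exp (q z / 2)"]) (auto intro!: continuous_intros)
    next
      case 4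
      have "p0 z * p1 z = (cnj (z - \<xi>0) * exp (cnj (q z) / 2))\<^sup>2" if "z \<in> S" for z
        unfolding 4 power_mult_distrib sq q(2)[OF that] by (simp add: exp_cnj power2_eq_square)
      then show ?thesis using q(1)
        by (intro exI[of _ "\<lambda>z. cnj (z - \<xi>0) * exp (cnj (q z) / 2)"]) (auto intro!: continuous_intros)
    qed
  qed
  then obtain \<tau> where \<tau>: "continuous_on S \<tau>" "\<And>z. z \<in> S \<Longrightarrow> p0 z * p1 z = (\<tau> z)\<^sup>2" by blast
  show thesis
  proof
    show "continuous_on S (\<lambda>z. s z * \<tau> z)"
      using continuous_on_subset[OF s(1) S(2)] \<tau>(1) by (intro continuous_intros)
    show "f z = (s z * \<tau> z)\<^sup>2" if "z \<in> S" for z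
      using f \<tau>(2) that by (simp add: power_mult_distrib)
  qed
qed

text \<open>The ratio of \<open>\<delta>\<close> to \<open>\<sigma>\<close> along \<open>c\<close>
  is continuous with values in \<open>{1, -1}\<close>, hence constant on the connected line.\<close>

lemma continuous_ratio_of_square_roots:
  fixes \<delta> :: "real \<Rightarrow> complex"
  assumes "continuous_on UNIV \<delta>" "continuous_on (range c) \<sigma>" "continuous_on UNIV c"
    and "\<And>t. (\<delta> t)\<^sup>2 = (\<sigma> (c t))\<^sup>2" "\<And>t. \<delta> t \<noteq> 0" "c x = c y"
  shows "\<delta> x = \<delta> y"
proof -
  have nz: "\<sigma> (c t) \<noteq> 0" for t using assms(4)[of t] assms(5)[of t] by auto
  define \<rho> where "\<rho> t = \<delta> t / \<sigma> (c t)" for t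
  have "continuous_on UNIV \<rho>"
    unfolding \<rho>_def using nz assms(1)
    by (intro continuous_intros continuous_on_compose2[OF assms(2,3)]) auto
  moreover have "range \<rho> \<subseteq> {1, -1}"
  proof
    fix y assume "y \<in> range \<rho>"
    then obtain t where "y = \<rho> t" by auto
    then show "y \<in> {1, -1}" using assms(4)[of t] nz[of t] by (auto simp: \<rho>_def power2_eq_iff)
  qed
  then have "finite (range \<rho>)" by (rule finite_subset) simp
  ultimately have "\<rho> constant_on UNIV"
    by (intro continuous_finite_range_constant connected_UNIV)
  then have "\<rho> x = \<rho> y" by (auto simp: constant_on_def)
  then show ?thesis using assms(6) nz[of x] by (simp add: \<rho>_def)
qed

section \<open>Transported eigenvector matrices\<close>

lemma matrix_inv_inverse:
  assumes "invertible M"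
  shows "M ** matrix_inv M = mat 1" "matrix_inv M ** M = mat 1"
  using someI_ex[OF assms[unfolded invertible_def]] unfolding matrix_inv_def by auto

lemma Ck_on_imp_continuous_on: "Ck_on k S f \<Longrightarrow> continuous_on S f"
  by (cases k) (auto intro!: continuous_at_imp_continuous_on differentiable_imp_continuous_within)

lemma matrix_entry_has_vector_derivative:
  fixes M :: "real \<Rightarrow> complex^'n^'m"
  assumes "(M has_vector_derivative D) F"
  shows "((\<lambda>t. M t $ i $ j) has_vector_derivative D $ i $ j) F"
  by (intro bounded_linear.has_vector_derivative[OF bounded_linear_vec_nth] assms)

lemma has_vector_derivative_zero_imp_constant:
  assumes "\<And>t. (f has_vector_derivative 0) (at t)"
  shows "f s = f t"
  using has_vector_derivative_zero_constant[of UNIV f] assms by (metis UNIV_I convex_UNIV)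

lemma mult_diag_matrix_nth [simp]:
  "(M ** diag_matrix d) $ i $ j = M $ i $ j * d $ j"
  "(diag_matrix d ** M) $ i $ j = d $ i * M $ i $ j"
  for M :: "'a::comm_semiring_1^'n^'n"
  by (simp_all add: matrix_matrix_mult_def diag_matrix_def if_distrib if_distribR cong: if_cong)

text \<open>\<open>matrix_inv V ** W\<close> commutes with a diagonal matrix whose entries are
  pairwise distinct, so its off-diagonal entries vanish.\<close>

lemma eigenvector_matrices_proportional:
  fixes V W :: "complex^'n^'n"
  assumes "invertible V" "invertible W" and inj: "inj (\<lambda>i. l $ i)"
    and eq: "V ** diag_matrix l ** matrix_inv V = W ** diag_matrix l ** matrix_inv W"
  obtains d where "matrix_inv V ** W = diag_matrix d" "W = V ** diag_matrix d"
proof -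
  define M where "M = matrix_inv V ** W"
  have VM: "V ** M = W"
    by (simp add: M_def matrix_mul_assoc matrix_inv_inverse assms(1))
  have "diag_matrix l ** M = matrix_inv V ** (V ** diag_matrix l ** matrix_inv V) ** W"
    unfolding M_def by (simp add: matrix_mul_assoc matrix_inv_inverse assms(1))
  also have "\<dots> = M ** diag_matrix l ** (matrix_inv W ** W)"
    unfolding eq M_def by (simp add: matrix_mul_assoc)
  finally have comm: "diag_matrix l ** M = M ** diag_matrix l"
    by (simp add: matrix_inv_inverse assms(2))
  have "M $ i $ j = 0" if "i \<noteq> j" for i j
  proof -
    have "l $ i * M $ i $ j = M $ i $ j * l $ j"
      using arg_cong[OF comm, of "\<lambda>X. X $ i $ j"] by simp
    then show ?thesis using inj that by (auto simp: inj_def mult.commute)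
  qed
  then have "M = diag_matrix (\<chi> i. M $ i $ i)"
    by (auto simp: diag_matrix_def vec_eq_iff)
  with VM show thesis using that by (metis M_def)
qed

lemma herm_prod_self: "herm_prod v v = of_real ((norm v)\<^sup>2)"
proof -
  have "(norm v)\<^sup>2 = (\<Sum>i\<in>UNIV. (norm (v $ i))\<^sup>2)"
    by (simp add: norm_vec_def L2_set_def sum_nonneg)
  then show ?thesis
    by (simp add: herm_prod_def mult.commute flip: complex_norm_square)
qed

text \<open>Since \<open>V' = V P\<close>, the derivative of the squared norm of column
  \<open>j\<close> is twice the sum in the hypothesis, which is the transport condition with its
  diagonal term brought to the same side.\<close>

lemma norm_transported_column_constant:
  fixes V P :: "real \<Rightarrow> complex^'n^'n"
  assumes V': "\<And>t. (V has_vector_derivative V t ** P t) (at t)"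
    and P: "\<And>t. (\<Sum>l\<in>UNIV. Re (herm_prod (column j (V t)) (column l (V t)) * P t $ l $ j)) = 0"
  shows "norm (column j (V s)) = norm (column j (V t))"
proof -
  have "((\<lambda>t. herm_prod (column j (V t)) (column j (V t))) has_vector_derivative 0) (at t)" for t
  proof -
    let ?D = "\<Sum>i\<in>UNIV. cnj (V t $ i $ j) * (V t ** P t) $ i $ j"
    have "((\<lambda>t. herm_prod (column j (V t)) (column j (V t))) has_vector_derivative
        (\<Sum>i\<in>UNIV. cnj (V t $ i $ j) * (V t ** P t) $ i $ j + cnj ((V t ** P t) $ i $ j) * V t $ i $ j)) (at t)"
      unfolding herm_prod_def column_def vec_lambda_beta
      by (intro derivative_intros matrix_entry_has_vector_derivative V')
    also have "(\<Sum>i\<in>UNIV. cnj (V t $ i $ j) * (V t ** P t) $ i $ j + cnj ((V t ** P t) $ i $ j) * V t $ i $ j) = ?D + cnj ?D"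
      by (simp add: sum.distrib mult.commute)
    also have "\<dots> = of_real (2 * Re ?D)"
      by (rule complex_add_cnj)
    also have "?D = (\<Sum>i\<in>UNIV. \<Sum>l\<in>UNIV. cnj (V t $ i $ j) * V t $ i $ l * P t $ l $ j)"
      by (simp add: matrix_matrix_mult_def sum_distrib_left mult_ac)
    also have "\<dots> = (\<Sum>l\<in>UNIV. herm_prod (column j (V t)) (column l (V t)) * P t $ l $ j)"
      by (subst sum.swap) (simp add: herm_prod_def column_def sum_distrib_right)
    also have "Re \<dots> = 0" using P by simp
    finally show ?thesis by simp
  qed
  then have "complex_of_real ((norm (column j (V s)))\<^sup>2) = of_real ((norm (column j (V t)))\<^sup>2)"
    unfolding herm_prod_self[symmetric] by (rule has_vector_derivative_zero_imp_constant)
  then have "(norm (column j (V s)))\<^sup>2 = (norm (column j (V t)))\<^sup>2"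
    unfolding of_real_eq_iff .
  then show ?thesis by simp
qed

lemma column_nonzero:
  fixes M :: "'a::field^'n^'n"
  assumes "invertible M"
  shows "column j M \<noteq> 0"
proof
  assume "column j M = 0"
  then have "M *v axis j 1 = M *v 0" by (simp add: vec_eq_iff column_def matrix_vector_mult_def axis_def if_distrib cong: if_cong)
  moreover have "inj ((*v) M)" using assms by (simp add: invertible_eq_bij bij_is_inj)
  ultimately have "axis j (1::'a) = 0" by (simp only: inj_eq)
  then show False by (simp add: axis_eq_0_iff)
qed

text \<open>Differentiating \<open>W = V D\<close> gives \<open>D' = D (Q\<^sub>j\<^sub>j - P\<^sub>j\<^sub>j)\<close> on the diagonal; reality of
  \<open>P\<^sub>j\<^sub>j\<close> and \<open>Q\<^sub>j\<^sub>j\<close> fixes the phase of \<open>d\<^sub>j\<close>, the norms of the columns fix its modulus.\<close>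

lemma transport_ratio_constant:
  fixes V W P Q :: "real \<Rightarrow> complex^'n^'n"
  assumes V': "\<And>t. (V has_vector_derivative V t ** P t) (at t)"
    and W': "\<And>t. (W has_vector_derivative W t ** Q t) (at t)"
    and inv: "\<And>t. invertible (V t)"
    and WV: "\<And>t. W t = V t ** diag_matrix (d t)"
    and real: "\<And>t. Im (P t $ j $ j) = 0" "\<And>t. Im (Q t $ j $ j) = 0"
    and normV: "\<And>s t. norm (column j (V s)) = norm (column j (V t))"
    and normW: "\<And>s t. norm (column j (W s)) = norm (column j (W t))"
  shows "d s $ j = d t $ j"
proof (rule has_vector_derivative_zero_imp_constant)
  fix t
  have nz: "herm_prod (column j (V t)) (column j (V t)) \<noteq> 0" for t
    unfolding herm_prod_self using column_nonzero[OF inv] by simp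
  \<comment> \<open>\<open>d\<close> is not assumed differentiable; writing it as an inner product
    of differentiable columns over a constant shows that it is.\<close>
  have d: "d t $ j = (\<Sum>i\<in>UNIV. cnj (V t $ i $ j) * W t $ i $ j) / of_real ((norm (column j (V 0)))\<^sup>2)" for t
  proof -
    have "(\<Sum>i\<in>UNIV. cnj (V t $ i $ j) * W t $ i $ j) = herm_prod (column j (V t)) (column j (V t)) * d t $ j"
      by (simp add: herm_prod_def column_def WV sum_distrib_right mult.assoc)
    then show ?thesis using nz[of t] normV[of t 0] by (simp add: herm_prod_self)
  qed
  obtain e where e: "((\<lambda>t. d t $ j) has_vector_derivative e) (at t)"
  proof -
    have "((\<lambda>t. (\<Sum>i\<in>UNIV. cnj (V t $ i $ j) * W t $ i $ j) / of_real ((norm (column j (V 0)))\<^sup>2))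
      has_vector_derivative (\<Sum>i\<in>UNIV. cnj (V t $ i $ j) * (W t ** Q t) $ i $ j +
        cnj ((V t ** P t) $ i $ j) * W t $ i $ j) / of_real ((norm (column j (V 0)))\<^sup>2)) (at t)"
      by (intro derivative_intros matrix_entry_has_vector_derivative V' W')
    then show thesis using that by (simp only: d)
  qed
  define r where "r = Q t $ j $ j - P t $ j $ j"
  \<comment> \<open>Column \<open>j\<close> of \<open>W = V D\<close> is differentiated in two ways
    and \<open>V\<close> is cancelled; component \<open>j\<close> then reads
    \<open>e = r * d t $ j\<close>.\<close>
  have "V t *v (\<chi> l. d t $ l * Q t $ l $ j) = V t *v (\<chi> l. P t $ l $ j * d t $ j + (if l = j then e else 0))"
  proof (rule vec_eq_iff[THEN iffD2], intro allI)
    fix i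
    have "((\<lambda>t. V t $ i $ j * d t $ j) has_vector_derivative (W t ** Q t) $ i $ j) (at t)"
      using matrix_entry_has_vector_derivative[OF W', of i j] by (simp add: WV)
    moreover have "((\<lambda>t. V t $ i $ j * d t $ j) has_vector_derivative
        V t $ i $ j * e + (V t ** P t) $ i $ j * d t $ j) (at t)"
      by (intro derivative_intros matrix_entry_has_vector_derivative V' e)
    ultimately have "(W t ** Q t) $ i $ j = V t $ i $ j * e + (V t ** P t) $ i $ j * d t $ j"
      by (rule vector_derivative_unique_at)
    moreover have "W t $ i $ l = V t $ i $ l * d t $ l" for l by (simp add: WV)
    then have "(W t ** Q t) $ i $ j = (V t *v (\<chi> l. d t $ l * Q t $ l $ j)) $ i"
      by (simp add: matrix_matrix_mult_def matrix_vector_mult_def mult.assoc)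
    moreover have "V t $ i $ j * e + (V t ** P t) $ i $ j * d t $ j =
        (V t *v (\<chi> l. P t $ l $ j * d t $ j + (if l = j then e else 0))) $ i"
      by (simp only: matrix_vector_mult_def vec_lambda_beta distrib_left sum.distrib)
        (simp add: matrix_matrix_mult_def sum_distrib_right mult.assoc if_distrib cong: if_cong)
    ultimately show "(V t *v (\<chi> l. d t $ l * Q t $ l $ j)) $ i =
        (V t *v (\<chi> l. P t $ l $ j * d t $ j + (if l = j then e else 0))) $ i" by simp
  qed
  then have "(\<chi> l. d t $ l * Q t $ l $ j) = (\<chi> l. P t $ l $ j * d t $ j + (if l = j then e else 0))"
    using inv[of t] by (simp add: invertible_eq_bij bij_is_inj inj_eq)
  from arg_cong[OF this, of "\<lambda>v. v $ j"] have er: "e = r * d t $ j"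
    by (simp add: r_def algebra_simps)
  have rr: "cnj r = r"
    using real by (simp add: r_def complex_eq_iff)
  have "((\<lambda>t. cnj (d t $ j) * d t $ j) has_vector_derivative cnj (d t $ j) * e + cnj e * d t $ j) (at t)"
    by (intro derivative_intros e)
  moreover have "cnj (d s $ j) * d s $ j = cnj (d t $ j) * d t $ j" for s t
  proof -
    have "column j (W t) = d t $ j *s column j (V t)" for t
      by (simp add: vec_eq_iff column_def WV mult.commute)
    then have "norm (column j (W t)) = norm (d t $ j) * norm (column j (V t))" for t
      by (simp add: norm_vec_def L2_set_right_distrib norm_mult)
    then have "norm (d s $ j) = norm (d t $ j)"
      using normV[of s t] normW[of s t] column_nonzero[OF inv, of j t] by simp
    then show ?thesis by (metis complex_norm_square mult.commute)
  qed
  then have "((\<lambda>t. cnj (d t $ j) * d t $ j) has_vector_derivative 0) (at t)"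
    by (metis (no_types, lifting) ext has_vector_derivative_const)
  ultimately have "cnj (d t $ j) * e + cnj e * d t $ j = 0"
    by (rule vector_derivative_unique_at)
  \<comment> \<open>As \<open>r\<close> is real, constancy of the modulus gives this equation.
    Either \<open>r\<close> or \<open>d t $ j\<close> vanishes, and both are factors of
    \<open>e\<close>.\<close>
  then have "2 * r * (d t $ j * cnj (d t $ j)) = 0"
    by (simp add: er rr algebra_simps)
  then have "e = 0" by (auto simp: er)
  with e show "((\<lambda>t. d t $ j) has_vector_derivative 0) (at t)" by simp
qed

section \<open>Determinants of transported frames\<close>

text \<open>The normalised \<open>h = g / g t\<close> solves the same equation, and
  \<open>cnj h / h\<close> has derivative zero because the coefficient is real. Since
  \<open>h t = 1\<close>, \<open>h\<close> is real everywhere; continuous and never zero, it stays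
  positive.\<close>

lemma real_logarithmic_derivative_imp_positive_ratio:
  fixes g :: "real \<Rightarrow> complex"
  assumes g': "\<And>t. (g has_vector_derivative of_real (r t) * g t) (at t)"
    and nz: "\<And>t. g t \<noteq> 0"
  obtains c where "c > 0" "g s = of_real c * g t"
proof -
  define h where "h u = g u / g t" for u
  have h': "(h has_vector_derivative of_real (r u) * h u) (at u)" for u
    unfolding h_def using has_vector_derivative_divide[OF g', of "g t" u] by simp
  have hnz: "h u \<noteq> 0" for u by (simp add: h_def nz)
  have "((\<lambda>u. cnj (h u) * inverse (h u)) has_vector_derivative 0) (at u)" for u
  proof -
    have "((\<lambda>u. inverse (h u)) has_vector_derivative of_real (r u) * h u * - (inverse (h u) ^ Suc (Suc 0))) (at u)"
      using field_vector_diff_chain_at[OF h' DERIV_inverse[OF hnz]] by (simp add: o_def)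
    from has_vector_derivative_mult[OF has_vector_derivative_cnj[OF h'] this]
    show ?thesis using hnz by (simp add: field_simps)
  qed
  from has_vector_derivative_zero_imp_constant[OF this]
  have "cnj (h u) * inverse (h u) = cnj (h t) * inverse (h t)" for u .
  then have "cnj (h u) = h u" for u
    using hnz[of u] nz by (simp add: h_def[of t] field_simps)
  then have im: "Im (h u) = 0" for u
    by (metis Im_complex_of_real Reals_cases Reals_cnj_iff)
  have "continuous_on UNIV h"
    using h' by (intro continuous_at_imp_continuous_on ballI has_vector_derivative_continuous) blast
  then have "connected (range (\<lambda>u. Re (h u)))"
    by (intro connected_continuous_image continuous_intros) auto
  moreover have "Re (h u) \<noteq> 0" for u
    using hnz[of u] im[of u] by (simp add: complex_eq_iff)
  moreover have "Re (h t) = 1" by (simp add: h_def nz)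
  ultimately have "Re (h s) > 0"
    using connectedD_interval[of "range (\<lambda>u. Re (h u))" "Re (h s)" "Re (h t)" 0] by force
  moreover have "g s = of_real (Re (h s)) * g t"
  proof -
    have "of_real (Re (h s)) = h s" using im[of s] by (simp add: complex_eq_iff)
    then show ?thesis by (simp add: h_def nz)
  qed
  ultimately show thesis by (rule that)
qed

text \<open>Jacobi's formula in dimension two, with \<open>V' = V P\<close>.\<close>

lemma det_has_vector_derivative_2:
  fixes V :: "real \<Rightarrow> complex^2^2"
  assumes "(V has_vector_derivative V t ** P) (at t)"
  shows "((\<lambda>t. det (V t)) has_vector_derivative trace P * det (V t)) (at t)"
proof -
  have "((\<lambda>t. det (V t)) has_vector_derivative
      (V t $ 1 $ 1 * (V t ** P) $ 2 $ 2 + (V t ** P) $ 1 $ 1 * V t $ 2 $ 2) -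
      (V t $ 1 $ 2 * (V t ** P) $ 2 $ 1 + (V t ** P) $ 1 $ 2 * V t $ 2 $ 1)) (at t)"
    unfolding det_2 by (intro derivative_intros matrix_entry_has_vector_derivative assms)
  then show ?thesis
    by (rule back_subst[of "\<lambda>D. (_ has_vector_derivative D) _"])
      (simp add: det_2 trace_def sum_2 matrix_matrix_mult_def algebra_simps)
qed

section \<open>Discriminants and eigenvalues of two-by-two matrices\<close>

text \<open>This is the discriminant of the characteristic polynomial; the form in trace and
  determinant makes its similarity invariance visible.\<close>

lemma discr_conv_trace_det: "discr M = (trace M)\<^sup>2 - 4 * det M"
  by (simp add: discr_def trace_def det_2 sum_2 power2_eq_square algebra_simps)

lemma trace_similar:
  fixes V :: "complex^'n^'n"
  assumes "invertible V"
  shows "trace (V ** D ** matrix_inv V) = trace D"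
  using matrix_inv_inverse[OF assms] by (metis matrix_mul_assoc matrix_mul_lid trace_mul_sym)

lemma det_similar:
  fixes V :: "complex^'n^'n"
  assumes "invertible V"
  shows "det (V ** D ** matrix_inv V) = det D"
  using matrix_inv_inverse[OF assms] by (metis det_mul mult.commute matrix_mul_assoc matrix_mul_lid)

lemma discr_diag_matrix: "discr (diag_matrix l) = (l $ 1 - l $ 2)\<^sup>2"
  by (simp add: discr_def diag_matrix_def)

text \<open>Since \<open>4 * det (M - mat \<mu>) + discr M = (2 * \<mu> - trace M)^2\<close>, a
  vanishing discriminant leaves \<open>trace M / 2\<close> as the only possible eigenvalue.\<close>

lemma discr_nonzero_if_distinct_eigenvalues:
  assumes "distinct_eigenvalues M"
  shows "discr M \<noteq> 0"
proof
  assume disc: "discr M = 0"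
  have "\<mu> = trace M / 2" if ev: "\<mu> \<in> eigenvalues M" for \<mu>
  proof -
    obtain v where "v \<noteq> 0" and v: "M *v v = \<mu> *s v"
      using ev by (auto simp: eigenvalues_def)
    have "(M - mat \<mu>) *v v = 0"
      using v by (simp add: matrix_vector_mult_diff_rdistrib) (simp add: vec_eq_iff matrix_vector_mult_def mat_def if_distrib if_distribR cong: if_cong)
    then have "det (M - mat \<mu>) = 0"
      using \<open>v \<noteq> 0\<close> by (metis invertible_det_nz invertible_eq_bij bij_is_inj injD matrix_vector_mult_0_right)
    then have "4 * det (M - mat \<mu>) + discr M = 0" using disc by simp
    moreover have "4 * det (M - mat \<mu>) + discr M = (2 * \<mu> - trace M)\<^sup>2"
      by (simp add: discr_def det_2 trace_def sum_2 mat_def power2_eq_square algebra_simps)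
    ultimately show ?thesis by (simp add: mult.commute)
  qed
  then have "eigenvalues M \<subseteq> {trace M / 2}" by auto
  then have "card (eigenvalues M) \<le> 1" by (metis card.empty card_insert_le_m1 card_mono finite.emptyI finite.insertI is_singletonI is_singleton_altdef)
  then show False using assms by (simp add: distinct_eigenvalues_def)
qed

section \<open>The discriminant along a Jordan curve\<close>

definition complex_of_vec :: "real^2 \<Rightarrow> complex" where
  "complex_of_vec x = Complex (x $ 1) (x $ 2)"

definition vec_of_complex :: "complex \<Rightarrow> real^2" where
  "vec_of_complex z = vector [Re z, Im z]"

lemma complex_of_vec_of_complex [simp]: "complex_of_vec (vec_of_complex z) = z"
  by (simp add: complex_of_vec_def vec_of_complex_def)

lemma vec_of_complex_of_vec [simp]: "vec_of_complex (complex_of_vec x) = x"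
  by (simp add: complex_of_vec_def vec_of_complex_def vec_eq_iff forall_2)

lemma linear_complex_of_vec: "linear complex_of_vec"
  by (intro linearI) (simp_all add: complex_of_vec_def complex_eq_iff)

lemma linear_vec_of_complex: "linear vec_of_complex"
  by (intro linearI) (simp_all add: vec_of_complex_def vec_eq_iff forall_2)

lemma bounded_linear_complex_of_vec: "bounded_linear complex_of_vec"
  by (simp add: linear_complex_of_vec linear_conv_bounded_linear[symmetric])

lemma bounded_linear_vec_of_complex: "bounded_linear vec_of_complex"
  by (simp add: linear_vec_of_complex linear_conv_bounded_linear[symmetric])

lemma homeomorphism_complex_of_vec: "homeomorphism UNIV UNIV complex_of_vec vec_of_complex"
  unfolding homeomorphism_def
  using linear_continuous_on[OF bounded_linear_complex_of_vec]
    linear_continuous_on[OF bounded_linear_vec_of_complex]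
  by (metis UNIV_I UNIV_eq_I complex_of_vec_of_complex image_eqI vec_of_complex_of_vec)

text \<open>Conjugating the Jacobian with the two linear identifications gives the real-linear
  derivative of the complex discriminant; an invertible Jacobian becomes an injective map.\<close>

lemma generic_cuspidal_point_has_derivative:
  assumes "generic_cuspidal_point \<Omega> A \<xi>"
  obtains L where "inj L"
    "((\<lambda>z. discr (A (vec_of_complex z))) has_derivative L) (at (complex_of_vec \<xi>))"
proof -
  let ?J = "jacobian (discr_map A) (at \<xi>)"
  have J: "(discr_map A has_derivative (*v) ?J) (at \<xi>)" "inj ((*v) ?J)"
    using assms jacobian_works
    by (auto simp: generic_cuspidal_point_def invertible_eq_bij bij_is_inj)
  have "((\<lambda>z. discr_map A (vec_of_complex z)) has_derivative (\<lambda>v. ?J *v vec_of_complex v)) (at (complex_of_vec \<xi>))"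
    using has_derivative_compose[OF bounded_linear_imp_has_derivative[OF bounded_linear_vec_of_complex]] J(1)
    by (metis vec_of_complex_of_vec)
  from bounded_linear.has_derivative[OF bounded_linear_complex_of_vec this]
  have "((\<lambda>z. discr (A (vec_of_complex z))) has_derivative (\<lambda>v. complex_of_vec (?J *v vec_of_complex v))) (at (complex_of_vec \<xi>))"
    by (simp add: discr_map_def complex_of_vec_def[of "vector _"])
  moreover have "inj (\<lambda>v. complex_of_vec (?J *v vec_of_complex v))"
    using J(2) unfolding inj_def by (metis complex_of_vec_of_complex vec_of_complex_of_vec)
  ultimately show thesis using that by blast
qed

lemma generic_cuspidal_point_discr: "generic_cuspidal_point \<Omega> A \<xi> \<Longrightarrow> discr (A \<xi>) = 0"
  by (simp add: generic_cuspidal_point_def discr_map_def vec_eq_iff forall_2 complex_eq_iff)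

text \<open>Paths are parametrised by \<open>{0..1}\<close>; periodicity shows that this interval
  already covers the whole range, through \<open>frac\<close>, and that the path closes up.\<close>

lemma smooth_Jordan_curve_simple_path:
  assumes "smooth_Jordan_curve \<gamma>"
  shows "continuous_on UNIV \<gamma>" "path_image (complex_of_vec \<circ> \<gamma>) = complex_of_vec ` range \<gamma>"
    "simple_path (complex_of_vec \<circ> \<gamma>)"
    "pathfinish (complex_of_vec \<circ> \<gamma>) = pathstart (complex_of_vec \<circ> \<gamma>)"
proof -
  show cont: "continuous_on UNIV \<gamma>"
    using assms by (simp add: smooth_Jordan_curve_def C1_differentiable_imp_continuous_on)
  have per: "\<gamma> (t + 1) = \<gamma> t" for t
    using assms by (simp add: smooth_Jordan_curve_def minimal_period_def)
  interpret periodic_fun_simple' \<gamma> by standard (rule per)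
  have "\<gamma> t = \<gamma> (frac t)" for t
    using minus_of_int[of t "\<lfloor>t\<rfloor>"] by (simp add: frac_def)
  moreover have "frac t \<in> {0..1}" for t :: real
    using frac_ge_0[of t] frac_lt_1[of t] by auto
  ultimately show "path_image (complex_of_vec \<circ> \<gamma>) = complex_of_vec ` range \<gamma>"
    unfolding path_image_def image_comp[symmetric] by (metis image_mono subset_UNIV subset_antisym image_subset_iff imageI)
  have \<gamma>1: "\<gamma> 1 = \<gamma> 0" by (rule of_1)
  have "loop_free \<gamma>"
    unfolding loop_free_def
  proof (intro ballI impI)
    fix x y :: real assume xy: "x \<in> {0..1}" "y \<in> {0..1}" "\<gamma> x = \<gamma> y"
    have inj: "inj_on \<gamma> {0..<1}" using assms by (simp add: smooth_Jordan_curve_def)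
    \<comment> \<open>The endpoint 1 is moved to 0, so that injectivity on the half-open interval
      applies.\<close>
    define x' where "x' = (if x = 1 then 0 else x)"
    define y' where "y' = (if y = 1 then 0 else y)"
    have "\<gamma> x' = \<gamma> y'" "x' \<in> {0..<1}" "y' \<in> {0..<1}" using xy \<gamma>1 by (auto simp: x'_def y'_def)
    with inj have "x' = y'" by (auto dest: inj_onD)
    then show "x = y \<or> x = 0 \<and> y = 1 \<or> x = 1 \<and> y = 0" by (auto simp: x'_def y'_def split: if_splits)
  qed
  then have "simple_path \<gamma>"
    using cont by (auto simp: simple_path_def path_def intro: continuous_on_subset)
  then show "simple_path (complex_of_vec \<circ> \<gamma>)"
    using simple_path_linear_image_eq[OF linear_complex_of_vec] homeomorphism_complex_of_vec
    by (metis (no_types, lifting) injI vec_of_complex_of_vec)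
  show "pathfinish (complex_of_vec \<circ> \<gamma>) = pathstart (complex_of_vec \<circ> \<gamma>)"
    by (simp add: pathfinish_def pathstart_def \<gamma>1)
qed

lemma transport_matrix_has_vector_derivative:
  assumes "Ck_on k UNIV V" "k \<ge> 1" "invertible (V t)"
  shows "(V has_vector_derivative V t ** transport_matrix V t) (at t)"
proof -
  have "V differentiable (at t)" using assms(1,2) by (cases k) auto
  then show ?thesis
    by (simp add: transport_matrix_def matrix_mul_assoc matrix_inv_inverse assms(3) vector_derivative_works)
qed

text \<open>The linear identification carries convexity, simple zeros and the inside of the curve to
  the complex plane, where the root is found and from where it is pulled back.\<close>

lemma discr_sqrt_on_Jordan_curve:
  assumes "convex \<Omega>" "continuous_on \<Omega> A" "\<xi>0 \<noteq> \<xi>1"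
    and g0: "generic_cuspidal_point \<Omega> A \<xi>0" and g1: "generic_cuspidal_point \<Omega> A \<xi>1"
    and nz: "\<And>\<xi>. \<xi> \<in> \<Omega> - {\<xi>0, \<xi>1} \<Longrightarrow> discr (A \<xi>) \<noteq> 0"
    and J: "smooth_Jordan_curve \<gamma>" "range \<gamma> \<subseteq> \<Omega>" "\<xi>0 \<in> inside (range \<gamma>)" "\<xi>1 \<in> inside (range \<gamma>)"
  obtains \<sigma> where "continuous_on (range \<gamma>) \<sigma>" "\<And>\<xi>. \<xi> \<in> range \<gamma> \<Longrightarrow> discr (A \<xi>) = (\<sigma> \<xi>)\<^sup>2"
proof -
  note path = smooth_Jordan_curve_simple_path[OF J(1)]
  define S where "S = complex_of_vec ` range \<gamma>"
  define \<Omega>' where "\<Omega>' = complex_of_vec ` \<Omega>"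
  define f where "f z = discr (A (vec_of_complex z))" for z
  obtain L0 L1 where L: "inj L0" "(f has_derivative L0) (at (complex_of_vec \<xi>0))"
      "inj L1" "(f has_derivative L1) (at (complex_of_vec \<xi>1))"
    using generic_cuspidal_point_has_derivative[OF g0] generic_cuspidal_point_has_derivative[OF g1]
    unfolding f_def by metis
  have "continuous_on \<Omega> (\<lambda>x. discr (A x))"
    unfolding discr_def by (intro continuous_intros assms(2))
  then have contf: "continuous_on \<Omega>' f"
    unfolding f_def \<Omega>'_def
    by (rule continuous_on_compose2[OF _ linear_continuous_on[OF bounded_linear_vec_of_complex]]) auto
  have ins: "complex_of_vec \<xi> \<in> inside S" if "\<xi> \<in> inside (range \<gamma>)" for \<xi>
    unfolding S_def using homeomorphism_complex_of_vec _ that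
    by (rule inside_homeomorphism_image) (rule bounded_linear_image[OF _ bounded_linear_complex_of_vec])
  have "connected_component (- S) (complex_of_vec \<xi>0) (complex_of_vec \<xi>1)"
    using inside_Jordan_curve_connected_component[OF path(3,4)] ins J(3,4) by (simp add: path(2) S_def)
  moreover have "compact S" "S \<subseteq> \<Omega>'"
    using compact_simple_path_image[OF path(3)] J(2) by (auto simp: path(2) S_def \<Omega>'_def)
  moreover have "convex \<Omega>'"
    unfolding \<Omega>'_def by (rule convex_linear_image[OF linear_complex_of_vec assms(1)])
  moreover have "complex_of_vec \<xi>0 \<noteq> complex_of_vec \<xi>1"
    using assms(3) by (metis vec_of_complex_of_vec)
  moreover have "f (complex_of_vec \<xi>0) = 0" "f (complex_of_vec \<xi>1) = 0"
    using g0 g1 by (simp_all add: f_def generic_cuspidal_point_discr)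
  moreover have "f z \<noteq> 0" if z: "z \<in> \<Omega>' - {complex_of_vec \<xi>0, complex_of_vec \<xi>1}" for z
  proof -
    obtain \<xi> where "z = complex_of_vec \<xi>" "\<xi> \<in> \<Omega> - {\<xi>0, \<xi>1}"
      using z unfolding \<Omega>'_def by blast
    then show ?thesis using nz by (simp add: f_def)
  qed
  ultimately obtain \<sigma> where \<sigma>: "continuous_on S \<sigma>" "\<And>z. z \<in> S \<Longrightarrow> f z = (\<sigma> z)\<^sup>2"
    using continuous_sqrt_two_simple_zeros[OF _ contf _ _ L(2,1) _ L(4,3)] by blast
  show thesis
  proof
    show "continuous_on (range \<gamma>) (\<lambda>x. \<sigma> (complex_of_vec x))"
      by (rule continuous_on_compose2[OF \<sigma>(1) linear_continuous_on[OF bounded_linear_complex_of_vec]])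
        (simp add: S_def)
    show "discr (A \<xi>) = (\<sigma> (complex_of_vec \<xi>))\<^sup>2" if "\<xi> \<in> range \<gamma>" for \<xi>
      using \<sigma>(2)[of "complex_of_vec \<xi>"] that by (simp add: f_def S_def)
  qed
qed

section \<open>Monodromy of eigenvalues and eigenvectors along the curve\<close>

theorem theorem2p25:
  fixes k :: nat
    and \<Omega> :: "(real^2) set"
    and A :: "real^2 \<Rightarrow> complex^2^2"
    and \<xi>0 \<xi>1 :: "real^2"
    and \<gamma> :: "real \<Rightarrow> real^2"
    and V :: "real \<Rightarrow> complex^2^2"
    and \<mu> :: "real \<Rightarrow> complex^2"
  assumes "k \<ge> 1"
    and "open \<Omega>" and "convex \<Omega>"
    and "Ck_on k \<Omega> A"
    and "\<xi>0 \<noteq> \<xi>1"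
    and "generic_cuspidal_point \<Omega> A \<xi>0"
    and "generic_cuspidal_point \<Omega> A \<xi>1"
    and "\<And>\<xi>. \<xi> \<in> \<Omega> - {\<xi>0, \<xi>1} \<Longrightarrow> distinct_eigenvalues (A \<xi>)"
    and "smooth_Jordan_curve \<gamma>"
    and "range \<gamma> \<subseteq> \<Omega>"
    and "\<xi>0 \<in> inside (range \<gamma>)" and "\<xi>1 \<in> inside (range \<gamma>)"
    and "minimal_period (\<lambda>t. A (\<gamma> t)) 1"
    and "parallel_transport_eigendecomposition k (\<lambda>t. A (\<gamma> t)) V \<mu>"
  shows "\<exists>\<alpha>1 \<alpha>2 :: real.
           [\<alpha>1 + \<alpha>2 = 0] (rmod (2 * pi)) \<and>
           (\<forall>t. (\<mu> (t + 1) $ 1 = \<mu> t $ 1 \<and> \<mu> (t + 1) $ 2 = \<mu> t $ 2) \<and>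
                matrix_inv (V t) ** V (t + 1) =
                  diag_matrix (vector [exp (\<i> * of_real \<alpha>1), exp (\<i> * of_real \<alpha>2)]))"
proof -
  define P where "P = transport_matrix V"
  have CkV: "Ck_on k UNIV V" and Ck\<mu>: "Ck_on k UNIV (\<lambda>t. diag_matrix (\<mu> t))"
    and inv: "\<And>t. invertible (V t)"
    and eig: "\<And>t. A (\<gamma> t) = V t ** diag_matrix (\<mu> t) ** matrix_inv (V t)"
    and normP: "\<And>j t. Re (herm_prod (column j (V t)) (column j (V t)) * P t $ j $ j) =
              - (\<Sum>l\<in>UNIV - {j}. Re (herm_prod (column j (V t)) (column l (V t)) * P t $ l $ j))"
    and realP: "\<And>j t. Im (P t $ j $ j) = 0"
    using assms(14) unfolding parallel_transport_eigendecomposition_def Ck_eigendecomposition_def P_def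
    by blast+
  have per: "\<gamma> (t + 1) = \<gamma> t" for t
    using assms(9) by (simp add: smooth_Jordan_curve_def minimal_period_def)
  have nz: "discr (A \<xi>) \<noteq> 0" if "\<xi> \<in> \<Omega> - {\<xi>0, \<xi>1}" for \<xi>
    using assms(8) that discr_nonzero_if_distinct_eigenvalues by blast
  have "\<gamma> t \<in> \<Omega> - {\<xi>0, \<xi>1}" for t
    using assms(10-12) by (auto simp: inside_def)
  then have nz\<gamma>: "discr (A (\<gamma> t)) \<noteq> 0" for t
    using nz by blast
  obtain \<sigma> where \<sigma>: "continuous_on (range \<gamma>) \<sigma>" "\<And>\<xi>. \<xi> \<in> range \<gamma> \<Longrightarrow> discr (A \<xi>) = (\<sigma> \<xi>)\<^sup>2"
    using discr_sqrt_on_Jordan_curve[OF assms(3) Ck_on_imp_continuous_on[OF assms(4)] assms(5-7) nz assms(9-12)]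
    by blast
  have disc: "discr (A (\<gamma> t)) = (\<mu> t $ 1 - \<mu> t $ 2)\<^sup>2" for t
    unfolding eig discr_conv_trace_det trace_similar[OF inv] det_similar[OF inv]
    by (simp flip: discr_conv_trace_det add: discr_diag_matrix)
  have tr: "trace (A (\<gamma> t)) = \<mu> t $ 1 + \<mu> t $ 2" for t
    unfolding eig trace_similar[OF inv] by (simp add: trace_def sum_2 diag_matrix_def)
  have "continuous_on UNIV (\<lambda>t. diag_matrix (\<mu> t) $ 1 $ 1 - diag_matrix (\<mu> t) $ 2 $ 2)"
    by (intro continuous_intros Ck_on_imp_continuous_on[OF Ck\<mu>])
  then have "continuous_on UNIV (\<lambda>t. \<mu> t $ 1 - \<mu> t $ 2)"
    by (simp add: diag_matrix_def)
  moreover have "(\<mu> t $ 1 - \<mu> t $ 2)\<^sup>2 = (\<sigma> (\<gamma> t))\<^sup>2" "\<mu> t $ 1 - \<mu> t $ 2 \<noteq> 0" for t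
    using disc[of t] \<sigma>(2)[of "\<gamma> t"] nz\<gamma>[of t] by auto
  \<comment> \<open>The eigenvalue difference is a fixed sign times the single-valued root
    \<open>\<sigma>\<close> along the curve, so the eigenvalues cannot be interchanged; the trace
    fixes their sum.\<close>
  ultimately have "\<mu> (t + 1) $ 1 - \<mu> (t + 1) $ 2 = \<mu> t $ 1 - \<mu> t $ 2" for t
    using continuous_ratio_of_square_roots[OF _ \<sigma>(1) smooth_Jordan_curve_simple_path(1)[OF assms(9)]] per
    by blast
  have "\<mu> (t + 1) $ 1 + \<mu> (t + 1) $ 2 = \<mu> t $ 1 + \<mu> t $ 2" for t
    using tr[of t] tr[of "t + 1"] per[of t] by simp
  have \<mu>: "\<mu> (t + 1) $ 1 = \<mu> t $ 1 \<and> \<mu> (t + 1) $ 2 = \<mu> t $ 2" for t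
  proof -
    have "x = x' \<and> y = y'" if "x - y = x' - y'" "x + y = x' + y'" for x y x' y' :: complex
      using that by (auto simp: complex_eq_iff)
    then show ?thesis
      using \<open>\<And>t. \<mu> (t + 1) $ 1 - \<mu> (t + 1) $ 2 = \<mu> t $ 1 - \<mu> t $ 2\<close>
        \<open>\<And>t. \<mu> (t + 1) $ 1 + \<mu> (t + 1) $ 2 = \<mu> t $ 1 + \<mu> t $ 2\<close> by blast
  qed
  then have \<mu>v: "\<mu> (t + 1) = \<mu> t" for t
    by (simp add: vec_eq_iff forall_2)
  have "\<exists>d. matrix_inv (V t) ** V (t + 1) = diag_matrix d \<and> V (t + 1) = V t ** diag_matrix d" for t
  proof -
    have "inj (\<lambda>i. \<mu> t $ i)"
      using disc[of t] nz\<gamma>[of t] by (auto simp: inj_def forall_2)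
    then show ?thesis
      using eigenvector_matrices_proportional[OF inv inv, of "\<mu> t" t "t + 1"] eig[of t] eig[of "t + 1"]
        per[of t] \<mu>v[of t] by metis
  qed
  then obtain d where d: "\<And>t. matrix_inv (V t) ** V (t + 1) = diag_matrix (d t)"
      "\<And>t. V (t + 1) = V t ** diag_matrix (d t)"
    by metis
  have V': "(V has_vector_derivative V t ** P t) (at t)" for t
    unfolding P_def by (rule transport_matrix_has_vector_derivative[OF CkV assms(1) inv])
  \<comment> \<open>The shifted frame satisfies the same transport conditions with \<open>P\<close>
    shifted, so the ratio of the two frames is constant.\<close>
  have W': "((\<lambda>t. V (t + 1)) has_vector_derivative V (t + 1) ** P (t + 1)) (at t)" for t
  proof -
    have "((\<lambda>t. t + 1 :: real) has_vector_derivative 1) (at t)"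
      by (auto intro!: derivative_eq_intros)
    from vector_diff_chain_at[OF this V'] show ?thesis by (simp add: o_def)
  qed
  have norm: "norm (column j (V s)) = norm (column j (V t))" for j s t
  proof (rule norm_transported_column_constant[OF V'])
    show "(\<Sum>l\<in>UNIV. Re (herm_prod (column j (V t)) (column l (V t)) * P t $ l $ j)) = 0" for t
      by (simp only: sum.remove[OF finite UNIV_I, of _ j] normP add.left_inverse)
  qed
  have const: "d t $ j = d 0 $ j" for t j
    by (rule transport_ratio_constant[OF V' W' inv d(2) realP realP norm norm])
  have dnorm: "norm (d 0 $ j) = 1" for j
  proof -
    have "column j (V (0 + 1)) = d 0 $ j *s column j (V 0)"
      unfolding d(2) by (simp add: vec_eq_iff column_def mult.commute)
    then have "norm (column j (V 1)) = norm (d 0 $ j) * norm (column j (V 0))"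
      by (simp add: norm_vec_def L2_set_right_distrib norm_mult)
    then show ?thesis using norm[of j 1 0] column_nonzero[OF inv, of j 0] by simp
  qed
  have "trace (P t) = of_real (Re (trace (P t)))" for t
    using realP by (simp add: trace_def complex_eq_iff)
  then have "((\<lambda>t. det (V t)) has_vector_derivative of_real (Re (trace (P t))) * det (V t)) (at t)" for t
    using det_has_vector_derivative_2[OF V'] by metis
  then obtain c where c: "c > 0" "det (V 1) = of_real c * det (V 0)"
  proof (rule real_logarithmic_derivative_imp_positive_ratio)
    show "det (V t) \<noteq> 0" for t using inv[of t] by (simp add: invertible_det_nz)
  qed
  \<comment> \<open>The product of the two diagonal entries is the determinant ratio, which is
    positive because the trace of \<open>P\<close> is real; with modulus one it must be 1.\<close>
  have "det (V (0 + 1)) = d 0 $ 1 * d 0 $ 2 * det (V 0)"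
    unfolding d(2) det_mul by (simp add: det_2 diag_matrix_def)
  then have "d 0 $ 1 * d 0 $ 2 = of_real c"
    using c(2) inv[of 0] by (simp add: invertible_det_nz)
  moreover from this have "norm (complex_of_real c) = 1"
    using dnorm by (metis mult.right_neutral norm_mult)
  ultimately have prod: "d 0 $ 1 * d 0 $ 2 = 1"
    using c(1) by simp
  \<comment> \<open>The phases are the principal arguments. Their sum is 0 only modulo
    \<open>2 * pi\<close>: two entries equal to -1 give \<open>2 * pi\<close>.\<close>
  have cisd: "cis (Arg (d 0 $ j)) = d 0 $ j" for j
  proof -
    have "d 0 $ j \<noteq> 0" using dnorm[of j] by auto
    then show ?thesis using dnorm[of j] cis_Arg[of "d 0 $ j"] by (simp add: sgn_div_norm)
  qed
  have "cis (Arg (d 0 $ 1) + Arg (d 0 $ 2)) = cis 0"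
    by (simp add: cisd prod flip: cis_mult)
  then have "[Arg (d 0 $ 1) + Arg (d 0 $ 2) = 0] (rmod (2 * pi))"
    by (simp only: cis_eq_iff)
  moreover have "d t = vector [exp (\<i> * of_real (Arg (d 0 $ 1))), exp (\<i> * of_real (Arg (d 0 $ 2)))]" for t
    by (simp add: vec_eq_iff forall_2 const[of t] cisd flip: cis_conv_exp)
  ultimately show ?thesis
    using \<mu> d(1) by metis
qed

end
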